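(* Assume that the minimised objective function $V(a,b)$ is differentiable at $(a^*,b^* )$ (in the sense specified in the context), and let $(S^*,\mu^* )$ be the pair described in the context. Then the derivative of the minimum cost $V^*$ of operating the store with respect to variation of the capacity $E$ is given by \[ \frac{\partial V^*}{\partial E}=\sum_{t\in\tau}(\mu^*_t-\rho\mu^*_{t+1}), \] where $\tau$ is the set of times $t$ such that $1\le t\le T-1$ and $S^*_t=E$.
   Context: Data: an integer $T\ge1$; a capacity $E>0$; rate constraints $P_i>0$ and $P_o>0$; a leakage parameter $\rho$ with $0<\rho\le1$; $X=\{x\in\mathbb{R}:-P_o\le x\le P_i\}$; convex cost functions $C_t:\mathbb{R}\to\mathbb{R}$, $1\le t\le T$; fixed real numbers $S^*_0$, $S^*_T$. For $S=(S_0,\dots,S_T)\in\mathbb{R}^{T+1}$ put $x_t(S)=S_t-\rho S_{t-1}$. Problem $\mathbf{P}$: minimise $\sum_{t=1}^T C_t(x_t(S))$ subject to $S_0=S^*_0$, $S_T=S^*_T$, $0\le S_t\le E$ for $1\le t\le T-1$, and $x_t(S)\in X$ for $1\le t\le T$. $S$ is feasible if it satisfies these constraints; the feasible set is assumed nonempty. Problem $\mathbf{P}(a,b)$, for $a=(a_1,\dots,a_T)$, $b=(b_1,\dots,b_T)$ with $a_t\le b_t$ for all $t$: minimise $\sum_{t=1}^T C_t(x_t(S))$ over $S$ with $S_0=S^*_0$, $a_t\le S_t\le b_t$ and $x_t(S)\in X$ for $1\le t\le T$. $V(a,b)$ denotes the minimum value ($+\infty$ if infeasible). Let $a^*_t=0$,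 $b^*_t=E$ for $1\le t\le T-1$ and $a^*_T=b^*_T=S^*_T$, so that $\mathbf{P}=\mathbf{P}(a^*,b^* )$, and write $V^*=V(a^*,b^* )$, regarded as a function of $E$ (all other data fixed) when differentiating with respect to $E$. Differentiability assumption: the function $(a_1,\dots,a_{T-1},b_1,\dots,b_{T-1},s)\mapsto V((a_1,\dots,a_{T-1},s),(b_1,\dots,b_{T-1},s))$ is finite in a neighbourhood of, and differentiable at, the point $a_t=0$, $b_t=E$ ($1\le t\le T-1$), $s=S^*_T$. The pair $(S^*,\mu^* )$, with $S^*=(S^*_0,\dots,S^*_T)$ and $\mu^*=(\mu^*_1,\dots,\mu^*_T)\in\mathbb{R}^T$, satisfies: (i) $S^*$ is feasible for $\mathbf{P}$; (ii) for each $1\le t\le T$, $x_t(S^* )$ minimises $C_t(x)-\mu^*_t x$ over $x\in X$; (iii) for $1\le t\le T-1$: $\rho\mu^*_{t+1}=\mu^*_t$ if $0<S^*_t<E$, $\rho\mu^*_{t+1}\le\mu^*_t$ if $S^*_t=0$, $\rho\mu^*_{t+1}\ge\mu^*_t$ if $S^*_t=E$. Such a pair exists, $S^*$ then solves $\mathbf{P}$, and under the differentiability assumption $\mu^*$ is uniquely determined. *)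

theory Defs
  imports "HOL-Analysis.Analysis"
begin

text \<open>
  A vector indexed by \<open>0..T\<close> or \<open>1..T\<close> is represented by a function on \<^typ>\<open>nat\<close>. All notions
  below use only its values at the relevant indices; the other values are irrelevant.
\<close>

definition rates :: "real \<Rightarrow> real \<Rightarrow> real set" where
  "rates Pin Pout = {- Pout..Pin}"

definition flow :: "real \<Rightarrow> (nat \<Rightarrow> real) \<Rightarrow> nat \<Rightarrow> real" where
  "flow \<rho> S t = S t - \<rho> * S (t - 1)"

definition total_cost ::
  "nat \<Rightarrow> real \<Rightarrow> (nat \<Rightarrow> real \<Rightarrow> real) \<Rightarrow> (nat \<Rightarrow> real) \<Rightarrow> real" where
  "total_cost T \<rho> C S = (\<Sum>t = 1..T. C t (flow \<rho> S t))"

definition feasible ::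
  "nat \<Rightarrow> real \<Rightarrow> real \<Rightarrow> real \<Rightarrow> real \<Rightarrow> real \<Rightarrow> real \<Rightarrow> (nat \<Rightarrow> real) \<Rightarrow> bool" where
  "feasible T E Pin Pout \<rho> s0 sT S \<longleftrightarrow>
     S 0 = s0 \<and> S T = sT \<and>
     (\<forall>t\<in>{1..<T}. 0 \<le> S t \<and> S t \<le> E) \<and>
     (\<forall>t\<in>{1..T}. flow \<rho> S t \<in> rates Pin Pout)"

definition feasible_box ::
  "nat \<Rightarrow> real \<Rightarrow> real \<Rightarrow> real \<Rightarrow> real \<Rightarrow> (nat \<Rightarrow> real) \<Rightarrow> (nat \<Rightarrow> real) \<Rightarrow> (nat \<Rightarrow> real) \<Rightarrow> bool" where
  "feasible_box T Pin Pout \<rho> s0 a b S \<longleftrightarrow>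
     S 0 = s0 \<and>
     (\<forall>t\<in>{1..T}. a t \<le> S t \<and> S t \<le> b t \<and> flow \<rho> S t \<in> rates Pin Pout)"

text \<open>
  The infimum of the empty set is \<open>\<infinity>\<close>. Otherwise the infimum is a minimum: the convex functions
  \<open>C t\<close> are continuous, and the feasible set, restricted to the indices \<open>0..T\<close>, is compact.
\<close>

definition value_box ::
  "nat \<Rightarrow> real \<Rightarrow> real \<Rightarrow> real \<Rightarrow> (nat \<Rightarrow> real \<Rightarrow> real) \<Rightarrow> real
    \<Rightarrow> (nat \<Rightarrow> real) \<Rightarrow> (nat \<Rightarrow> real) \<Rightarrow> ereal" where
  "value_box T Pin Pout \<rho> C s0 a b =
     (INF S\<in>{S. feasible_box T Pin Pout \<rho> s0 a b S}. ereal (total_cost T \<rho> C S))"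

definition with_end :: "nat \<Rightarrow> real \<Rightarrow> (nat \<Rightarrow> real) \<Rightarrow> nat \<Rightarrow> real" where
  "with_end T s a t = (if t = T then s else a t)"

definition min_cost ::
  "nat \<Rightarrow> real \<Rightarrow> real \<Rightarrow> real \<Rightarrow> (nat \<Rightarrow> real \<Rightarrow> real) \<Rightarrow> real \<Rightarrow> real \<Rightarrow> real \<Rightarrow> ereal" where
  "min_cost T Pin Pout \<rho> C s0 sT E =
     value_box T Pin Pout \<rho> C s0 (with_end T sT (\<lambda>t. 0)) (with_end T sT (\<lambda>t. E))"

lemma feasible_eq_feasible_box:
  assumes "T \<ge> 1"
  shows "feasible T E Pin Pout \<rho> s0 sT S \<longleftrightarrow>
    feasible_box T Pin Pout \<rho> s0 (with_end T sT (\<lambda>t. 0)) (with_end T sT (\<lambda>t. E)) S"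
proof -
  have "{1..T} = insert T {1..<T}"
    using assms by auto
  then show ?thesis
    by (auto simp: feasible_def feasible_box_def with_end_def)
qed

definition optimality_pair ::
  "nat \<Rightarrow> real \<Rightarrow> real \<Rightarrow> real \<Rightarrow> real \<Rightarrow> (nat \<Rightarrow> real \<Rightarrow> real) \<Rightarrow> real \<Rightarrow> real
    \<Rightarrow> (nat \<Rightarrow> real) \<Rightarrow> (nat \<Rightarrow> real) \<Rightarrow> bool" where
  "optimality_pair T E Pin Pout \<rho> C s0 sT S \<mu> \<longleftrightarrow>
     feasible T E Pin Pout \<rho> s0 sT S \<and>
     (\<forall>t\<in>{1..T}. is_arg_min (\<lambda>x. C t x - \<mu> t * x) (\<lambda>x. x \<in> rates Pin Pout) (flow \<rho> S t)) \<and>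
     (\<forall>t\<in>{1..<T}.
        (0 < S t \<and> S t < E \<longrightarrow> \<rho> * \<mu> (t + 1) = \<mu> t) \<and>
        (S t = 0 \<longrightarrow> \<rho> * \<mu> (t + 1) \<le> \<mu> t) \<and>
        (S t = E \<longrightarrow> \<rho> * \<mu> (t + 1) \<ge> \<mu> t))"

text \<open>
  The parameters \<open>(a\<^sub>1, \<dots>, a\<^sub>T\<^sub>-\<^sub>1, b\<^sub>1, \<dots>, b\<^sub>T\<^sub>-\<^sub>1, s)\<close> form a vector of dimension \<open>2T - 1 \<ge> 1\<close>,
  represented as an element of \<open>real ^ 'n\<close>. A bijection \<open>lab\<close> from \<open>'n\<close> onto \<open>coords T\<close> says
  which coordinate is which: \<open>Lower t\<close> stands for \<open>a\<^sub>t\<close>, \<open>Upper t\<close> for \<open>b\<^sub>t\<close>, and \<open>Final\<close> for \<open>s\<close>.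
\<close>

datatype coord = Lower nat | Upper nat | Final

definition coords :: "nat \<Rightarrow> coord set" where
  "coords T = Lower ` {1..<T} \<union> Upper ` {1..<T} \<union> {Final}"

definition entry :: "('n::finite \<Rightarrow> coord) \<Rightarrow> real ^ 'n \<Rightarrow> coord \<Rightarrow> real" where
  "entry lab v c = v $ inv lab c"

definition value_param ::
  "nat \<Rightarrow> real \<Rightarrow> real \<Rightarrow> real \<Rightarrow> (nat \<Rightarrow> real \<Rightarrow> real) \<Rightarrow> real
    \<Rightarrow> ('n::finite \<Rightarrow> coord) \<Rightarrow> real ^ 'n \<Rightarrow> ereal" where
  "value_param T Pin Pout \<rho> C s0 lab v =
     value_box T Pin Pout \<rho> C s0
       (with_end T (entry lab v Final) (\<lambda>t. entry lab v (Lower t)))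
       (with_end T (entry lab v Final) (\<lambda>t. entry lab v (Upper t)))"

definition base_point :: "real \<Rightarrow> real \<Rightarrow> ('n::finite \<Rightarrow> coord) \<Rightarrow> real ^ 'n" where
  "base_point E sT lab =
     (\<chi> i. case lab i of Lower t \<Rightarrow> 0 | Upper t \<Rightarrow> E | Final \<Rightarrow> sT)"

lemma entry_base_point:
  assumes "bij_betw lab UNIV (coords T)" and "c \<in> coords T"
  shows "entry lab (base_point E sT lab) c =
    (case c of Lower t \<Rightarrow> 0 | Upper t \<Rightarrow> E | Final \<Rightarrow> sT)"
proof -
  have "lab (inv lab c) = c"
    using assms by (intro f_inv_into_f) (simp add: bij_betw_def)
  then show ?thesis
    by (simp add: entry_def base_point_def)
qed

end

theory Submission
  imports Defs
begin

text \<open>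
  The multipliers \<open>\<mu>\<close> supply an affine function of the capacity that lies below the minimum
  cost everywhere and agrees with it at \<open>E\<close>. Summation by parts turns the linearised cost
  \<open>\<Sum> \<mu>\<^sub>t x\<^sub>t(S)\<close> into \<open>\<Sum> (\<mu>\<^sub>t - \<rho> \<mu>\<^sub>t\<^sub>+\<^sub>1) S\<^sub>t\<close> plus boundary terms, which the two
  fixed end levels determine; complementary slackness then bounds the coefficient of each level
  in the right direction, and only the levels at the upper bound react to a change of capacity
  (\<open>total_cost_ge_of_optimality_pair\<close>, \<open>min_cost_ge\<close>, \<open>min_cost_eq\<close>).

  Changing the capacity moves the parameter vector of the value function along a straight line
  (\<open>base_point_affine\<close>), so differentiability of the value function makes the minimum cost a
  differentiable function of the capacity. A function that is differentiable at a point where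
  an affine minorant touches it has there the slope of the minorant.
\<close>

lemma sum_mult_flow_by_parts:
  "(\<Sum>t = 1..Suc n. \<mu> t * flow \<rho> D t) =
     (\<Sum>t = 1..n. (\<mu> t - \<rho> * \<mu> (t + 1)) * D t) + \<mu> (Suc n) * D (Suc n) - \<rho> * \<mu> 1 * D 0"
  by (induction n) (auto simp: flow_def algebra_simps)

text \<open>
  Optimality of each flow in its own Lagrangian problem bounds the cost of every other path
  from below by a linear function of the flows, hence of the levels. A coefficient
  \<open>\<mu>\<^sub>t - \<rho> \<mu>\<^sub>t\<^sub>+\<^sub>1\<close> is nonnegative where the level is \<open>0\<close> and cannot drop, nonpositive where the
  level is \<open>E\<close> and can rise by at most \<open>E' - E\<close>, and zero elsewhere.
\<close>

lemma total_cost_ge_of_optimality_pair: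
  assumes "T \<ge> 1"
    and opt: "optimality_pair T E Pin Pout \<rho> C s0 sT S \<mu>"
    and feas: "feasible T E' Pin Pout \<rho> s0 sT S'"
  shows "total_cost T \<rho> C S +
      (\<Sum>t\<in>{t\<in>{1..<T}. S t = E}. \<mu> t - \<rho> * \<mu> (t + 1)) * (E' - E) \<le> total_cost T \<rho> C S'"
proof -
  obtain n where T: "T = Suc n"
    using \<open>T \<ge> 1\<close> by (cases T) auto
  define D where "D t = S' t - S t" for t
  define l where "l t = \<mu> t - \<rho> * \<mu> (t + 1)" for t
  have S: "feasible T E Pin Pout \<rho> s0 sT S"
    using opt by (simp add: optimality_pair_def)
  have "D 0 = 0" and "D T = 0"
    using S feas by (simp_all add: D_def feasible_def)
  have pointwise: "C t (flow \<rho> S t) + \<mu> t * flow \<rho> D t \<le> C t (flow \<rho> S' t)"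
    if t: "t \<in> {1..T}" for t
  proof -
    have "flow \<rho> S' t \<in> rates Pin Pout"
      using feas t by (simp add: feasible_def)
    moreover have "is_arg_min (\<lambda>x. C t x - \<mu> t * x) (\<lambda>x. x \<in> rates Pin Pout) (flow \<rho> S t)"
      using opt t by (simp add: optimality_pair_def)
    ultimately have "C t (flow \<rho> S t) - \<mu> t * flow \<rho> S t \<le> C t (flow \<rho> S' t) - \<mu> t * flow \<rho> S' t"
      by (auto simp: is_arg_min_linorder)
    moreover have "flow \<rho> D t = flow \<rho> S' t - flow \<rho> S t"
      by (simp add: flow_def D_def algebra_simps)
    ultimately show ?thesis
      by (simp add: right_diff_distrib)
  qed
  have level: "(if S t = E then l t * (E' - E) else 0) \<le> l t * D t" if t: "t \<in> {1..<T}" for t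
  proof -
    have bounds: "0 \<le> S t" "S t \<le> E" "0 \<le> S' t" "S' t \<le> E'"
      using S feas t by (auto simp: feasible_def)
    have slack: "0 < S t \<and> S t < E \<longrightarrow> l t = 0" "S t = 0 \<longrightarrow> 0 \<le> l t" "S t = E \<longrightarrow> l t \<le> 0"
      using opt t by (auto simp: optimality_pair_def l_def)
    consider "S t = E" | "S t \<noteq> E" "S t = 0" | "0 < S t" "S t < E"
      using bounds by linarith
    then show ?thesis
      using bounds slack by cases (auto simp: D_def intro!: mult_left_mono_neg)
  qed
  have "(\<Sum>t\<in>{t\<in>{1..<T}. S t = E}. l t) * (E' - E) =
      (\<Sum>t\<in>{1..<T}. if S t = E then l t * (E' - E) else 0)"
    unfolding sum_distrib_right by (intro sum.inter_filter) simp
  also have "\<dots> \<le> (\<Sum>t\<in>{1..<T}. l t * D t)"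
    by (intro sum_mono level)
  also have "\<dots> = (\<Sum>t = 1..n. l t * D t)"
    by (simp add: T atLeastLessThanSuc_atLeastAtMost)
  also have "\<dots> = (\<Sum>t = 1..T. \<mu> t * flow \<rho> D t)"
    using \<open>D 0 = 0\<close> \<open>D T = 0\<close> unfolding T sum_mult_flow_by_parts l_def by simp
  finally have "total_cost T \<rho> C S + (\<Sum>t\<in>{t\<in>{1..<T}. S t = E}. l t) * (E' - E) \<le>
      (\<Sum>t = 1..T. C t (flow \<rho> S t) + \<mu> t * flow \<rho> D t)"
    by (simp add: total_cost_def sum.distrib)
  also have "\<dots> \<le> total_cost T \<rho> C S'"
    unfolding total_cost_def by (intro sum_mono pointwise)
  finally show ?thesis
    by (simp add: l_def)
qed

lemma min_cost_eq_INF_feasible: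
  assumes "T \<ge> 1"
  shows "min_cost T Pin Pout \<rho> C s0 sT E =
    (INF S\<in>{S. feasible T E Pin Pout \<rho> s0 sT S}. ereal (total_cost T \<rho> C S))"
  using assms by (simp add: min_cost_def value_box_def feasible_eq_feasible_box)

lemma min_cost_ge:
  assumes "T \<ge> 1" and "optimality_pair T E Pin Pout \<rho> C s0 sT S \<mu>"
  shows "ereal (total_cost T \<rho> C S +
      (\<Sum>t\<in>{t\<in>{1..<T}. S t = E}. \<mu> t - \<rho> * \<mu> (t + 1)) * (E' - E))
    \<le> min_cost T Pin Pout \<rho> C s0 sT E'"
  unfolding min_cost_eq_INF_feasible[OF assms(1)]
  by (intro INF_greatest) (use total_cost_ge_of_optimality_pair[OF assms] in auto)

lemma min_cost_eq:
  assumes "T \<ge> 1" and "optimality_pair T E Pin Pout \<rho> C s0 sT S \<mu>"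
  shows "min_cost T Pin Pout \<rho> C s0 sT E = ereal (total_cost T \<rho> C S)"
proof (rule antisym)
  have "feasible T E Pin Pout \<rho> s0 sT S"
    using assms(2) by (simp add: optimality_pair_def)
  then show "min_cost T Pin Pout \<rho> C s0 sT E \<le> ereal (total_cost T \<rho> C S)"
    unfolding min_cost_eq_INF_feasible[OF assms(1)] by (intro INF_lower) simp
  show "ereal (total_cost T \<rho> C S) \<le> min_cost T Pin Pout \<rho> C s0 sT E"
    using min_cost_ge[OF assms, of E] by simp
qed

lemma min_cost_eq_value_param:
  assumes "T \<ge> 1" and lab: "bij_betw lab UNIV (coords T)"
  shows "min_cost T Pin Pout \<rho> C s0 sT E = value_param T Pin Pout \<rho> C s0 lab (base_point E sT lab)"
proof -
  let ?e = "entry lab (base_point E sT lab)"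
  have "with_end T sT (\<lambda>t. 0) t = with_end T (?e Final) (\<lambda>t. ?e (Lower t)) t"
    and "with_end T sT (\<lambda>t. E) t = with_end T (?e Final) (\<lambda>t. ?e (Upper t)) t"
    if "t \<in> {1..T}" for t
    using that by (auto simp: with_end_def entry_base_point[OF lab] coords_def)
  then have "feasible_box T Pin Pout \<rho> s0 (with_end T sT (\<lambda>t. 0)) (with_end T sT (\<lambda>t. E)) S \<longleftrightarrow>
      feasible_box T Pin Pout \<rho> s0 (with_end T (?e Final) (\<lambda>t. ?e (Lower t)))
        (with_end T (?e Final) (\<lambda>t. ?e (Upper t))) S" for S
    by (simp add: feasible_box_def)
  then show ?thesis
    by (simp add: min_cost_def value_param_def value_box_def)
qed

lemma base_point_affine:
  "base_point E sT lab = base_point 0 sT lab + E *\<^sub>R base_point 1 0 lab"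
  by (simp add: vec_eq_iff base_point_def split: coord.split)

lemma base_point_has_derivative:
  "((\<lambda>E. base_point E sT lab) has_derivative (\<lambda>h. h *\<^sub>R base_point 1 0 lab)) (at E)"
  by (subst base_point_affine) (auto intro!: derivative_eq_intros)

text \<open>
  The difference of \<open>f\<close> and its minorant has a local minimum at the point of contact.
\<close>

lemma has_real_derivative_of_affine_minorant:
  fixes f :: "real \<Rightarrow> real"
  assumes diff: "f differentiable (at x)"
    and minorant: "\<forall>\<^sub>F y in nhds x. f x + k * (y - x) \<le> f y"
  shows "(f has_real_derivative k) (at x)"
proof -
  obtain D where D: "(f has_real_derivative D) (at x)"
    using diff by (auto simp: real_differentiable_def)
  then have deriv: "((\<lambda>y. f y - k * y) has_real_derivative D - k) (at x)"
    by (auto intro!: derivative_eq_intros)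
  obtain d where "d > 0" and d: "\<And>y. dist y x < d \<Longrightarrow> f x + k * (y - x) \<le> f y"
    using minorant by (auto simp: eventually_nhds_metric)
  have "\<forall>y. \<bar>x - y\<bar> < d \<longrightarrow> f x - k * x \<le> f y - k * y"
    using d by (force simp: dist_real_def abs_minus_commute algebra_simps)
  then have "D - k = 0"
    by (rule DERIV_local_min[OF deriv \<open>d > 0\<close>])
  then show ?thesis
    using D by simp
qed

theorem theorem4:
  fixes T :: nat
    and E Pin Pout \<rho> s0 sT :: real
    and C :: "nat \<Rightarrow> real \<Rightarrow> real"
    and S \<mu> :: "nat \<Rightarrow> real"
    and lab :: "'n::finite \<Rightarrow> coord"
  assumes "T \<ge> 1" and "E > 0" and "Pin > 0" and "Pout > 0" and "0 < \<rho>" and "\<rho> \<le> 1"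
    and "\<And>t. t \<in> {1..T} \<Longrightarrow> convex_on UNIV (C t)"
    and "\<exists>S'. feasible T E Pin Pout \<rho> s0 sT S'"
    and "bij_betw lab UNIV (coords T)"
    and "\<forall>\<^sub>F v in nhds (base_point E sT lab). \<bar>value_param T Pin Pout \<rho> C s0 lab v\<bar> \<noteq> \<infinity>"
    and "(\<lambda>v. real_of_ereal (value_param T Pin Pout \<rho> C s0 lab v))
           differentiable (at (base_point E sT lab))"
    and "optimality_pair T E Pin Pout \<rho> C s0 sT S \<mu>"
  shows "((\<lambda>E'. real_of_ereal (min_cost T Pin Pout \<rho> C s0 sT E')) has_real_derivative
           (\<Sum>t\<in>{t. 1 \<le> t \<and> t \<le> T - 1 \<and> S t = E}. \<mu> t - \<rho> * \<mu> (t + 1))) (at E)"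
proof -
  let ?W = "\<lambda>v. value_param T Pin Pout \<rho> C s0 lab v"
  let ?V = "min_cost T Pin Pout \<rho> C s0 sT"
  let ?p = "\<lambda>E'. base_point E' sT lab"
  define k where "k = (\<Sum>t\<in>{t\<in>{1..<T}. S t = E}. \<mu> t - \<rho> * \<mu> (t + 1))"
  have V_eq: "?V E' = ?W (?p E')" for E'
    using assms(1,9) by (rule min_cost_eq_value_param)
  have p_differentiable: "?p differentiable (at E)"
    using base_point_has_derivative by (rule differentiableI)
  then have "(\<lambda>v. real_of_ereal (?W v)) \<circ> ?p differentiable (at E)"
    using assms(11) by (rule differentiable_chain_at)
  then have V_differentiable: "(\<lambda>E'. real_of_ereal (?V E')) differentiable (at E)"
    by (simp add: V_eq o_def)
  have "filterlim ?p (nhds (?p E)) (nhds E)"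
    using differentiable_imp_continuous_within[OF p_differentiable]
    unfolding isCont_def by (subst (asm) tendsto_at_iff_tendsto_nhds)
  then have "\<forall>\<^sub>F E' in nhds E. \<bar>?V E'\<bar> \<noteq> \<infinity>"
    unfolding V_eq by (rule eventually_compose_filterlim[OF assms(10)])
  then have "\<forall>\<^sub>F E' in nhds E. real_of_ereal (?V E) + k * (E' - E) \<le> real_of_ereal (?V E')"
  proof eventually_elim
    case (elim E')
    have "ereal (real_of_ereal (?V E) + k * (E' - E)) \<le> ?V E'"
      using min_cost_ge[OF assms(1,12), of E'] min_cost_eq[OF assms(1,12)] by (simp add: k_def)
    also have "?V E' = ereal (real_of_ereal (?V E'))"
      using elim by (simp add: ereal_real)
    finally show ?case
      by simp
  qed
  with V_differentiable have "((\<lambda>E'. real_of_ereal (?V E')) has_real_derivative k) (at E)"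
    by (rule has_real_derivative_of_affine_minorant)
  moreover have "{t\<in>{1..<T}. S t = E} = {t. 1 \<le> t \<and> t \<le> T - 1 \<and> S t = E}"
    by auto
  ultimately show ?thesis
    by (simp add: k_def)
qed

end
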